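(* Let $K$ be a field, $n=p+q$ with $p,q\in\mathbb{N}$, and $Cl_n$ the Clifford algebra over $K$. Let $k\ge 1$ and let $f_1,\dots,f_k: Cl_n\to Cl_n$ be grade-negation operators. Put $S_0=Cl_n$ and $S_i=(S_{i-1})^{f_i}=\{\alpha\in S_{i-1} : f_i(\alpha)=\alpha\}$ for $1\le i\le k$. Assume that $f_i$ is a partial involution for $S_{i-1}$ for every $i\in\{1,\dots,k\}$ and that $S_k=K$ (i.e. $S_k=K\cdot 1$). Suppose that for each $i\in\{1,\dots,k\}$ at least one of the following conditions holds: (1) $(Cl_n)^{f_i}\subset S_{i-1}$; (2) $(S_{i-1}*S_{i-1})\cap (Cl_n)^{f_i}\subset S_i$. Then $f_k^{( * )}$ and $f_k^{(\natural)}$ are invertibility preserving maps for $Cl_n$ into $K$; that is, both maps take values in $K$, and for every $\alpha\in Cl_n$, $\alpha$ is invertible in $Cl_n$ if and only if $f_k^{( * )}(\alpha)$ is invertible in $K$, and $\alpha$ is invertible in $Cl_n$ if and only if $f_k^{(\natural)}(\alpha)$ is invertible in $K$.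
   Context: Clifford algebra: $Cl_n$ (with $n=p+q$) is the unital associative $K$-algebra with $K$-basis $\{1\}\cup\{e_{i_1}e_{i_2}\cdots e_{i_s} : 1\le i_1<i_2<\cdots<i_s\le n\}$ and relations $e_ie_j+e_je_i=0$ for $i\ne j$, $e_i^2=-1$ for $1\le i\le p$, $e_i^2=1$ for $p+1\le i\le n$. $K$ is identified with $K\cdot 1\subset Cl_n$. Grade-negation operator: for a map $\delta:\{0,1,\dots,n\}\to\{\pm1\}$, $f_\delta:Cl_n\to Cl_n$ is the $K$-linear map with $f_\delta(e_{i_1}\cdots e_{i_s})=\delta(s)\,e_{i_1}\cdots e_{i_s}$ for $1\le i_1<\cdots<i_s\le n$ (for $s=0$ the basis element is $1$). Partial involution: for a monoid $M$ and a subset $S\subset M$, a map $f:M\to M$ is a partial involution for $S$ if $f(\alpha\beta)=f(\beta)f(\alpha)$ and $f(f(\alpha))=\alpha$ for all $\alpha,\beta\in S$, and $f(1)=1$. Here $M=Cl_n$ under multiplication. Notation: for a map $f:Cl_n\to Cl_n$ and $S\subset Cl_n$, $S^f=\{\alpha\in S: f(\alpha)=\alpha\}$, $f^*(\alpha)=\alpha f(\alpha)$, $f^\natural(\alpha)=f(\alpha)\alpha$; $f_k^{( * )}=f_k^*\circ\cdots\circ f_1^*$ and $f_k^{(\natural)}=f_k^\natural\circ\cdots\circ f_1^\natural$; $S*S=\{\alpha\beta : \alpha,\beta\in S\}$. *)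

theory Defs
  imports Main HOL.Vector_Spaces "HOL-Library.Type_Length"
begin

section \<open>Clifford algebras\<close>

definition blade :: "(nat \<Rightarrow> 'a::monoid_mult) \<Rightarrow> nat set \<Rightarrow> 'a" where
  "blade e I = prod_list (map e (sorted_list_of_set I))"

text \<open>
  The locale says that the ring \<open>'a\<close>, with scalar multiplication \<open>scale\<close> and generators
  \<open>e 1, \<dots>, e (p + q)\<close>, is the Clifford algebra over the field \<open>'k\<close>; the values of \<open>e\<close>
  outside \<open>{1..p + q}\<close> are irrelevant.  Injectivity of \<^term>\<open>blade e\<close> is listed separately
  because \<open>independent\<close> concerns a set of vectors rather than an indexed family.
\<close>

locale clifford_algebra = vector_space scale
  for scale :: "'k::field \<Rightarrow> 'a::ring_1 \<Rightarrow> 'a" +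
  fixes p q :: nat and e :: "nat \<Rightarrow> 'a"
  assumes scale_mult_left: "scale c x * y = scale c (x * y)"
    and scale_mult_right: "x * scale c y = scale c (x * y)"
    and anticommute: "\<lbrakk>i \<in> {1..p + q}; j \<in> {1..p + q}; i \<noteq> j\<rbrakk> \<Longrightarrow> e i * e j + e j * e i = 0"
    and square_neg: "i \<in> {1..p} \<Longrightarrow> e i * e i = - 1"
    and square_pos: "i \<in> {p + 1..p + q} \<Longrightarrow> e i * e i = 1"
    and blade_inj: "inj_on (blade e) (Pow {1..p + q})"
    and blade_independent: "independent (blade e ` Pow {1..p + q})"
    and blade_span: "span (blade e ` Pow {1..p + q}) = UNIV"

text \<open>The copy \<open>K \<cdot> 1\<close> of the ground field inside the algebra.\<close>

definition scalars :: "('k \<Rightarrow> 'a::one \<Rightarrow> 'a) \<Rightarrow> 'a set" where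
  "scalars scale = range (\<lambda>c. scale c 1)"

definition grade_negation ::
    "('k::field \<Rightarrow> 'a::ring_1 \<Rightarrow> 'a) \<Rightarrow> nat \<Rightarrow> nat \<Rightarrow> (nat \<Rightarrow> 'a) \<Rightarrow> ('a \<Rightarrow> 'a) \<Rightarrow> bool" where
  "grade_negation scale p q e f \<longleftrightarrow>
     (\<exists>\<delta> :: nat \<Rightarrow> 'k. (\<forall>s \<in> {0..p + q}. \<delta> s \<in> {1, - 1}) \<and>
        Vector_Spaces.linear scale scale f \<and>
        (\<forall>I \<subseteq> {1..p + q}. f (blade e I) = scale (\<delta> (card I)) (blade e I)))"


section \<open>Partial involutions and invertibility preserving maps\<close>

definition partial_involution :: "('a::monoid_mult \<Rightarrow> 'a) \<Rightarrow> 'a set \<Rightarrow> bool" where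
  "partial_involution f S \<longleftrightarrow>
     (\<forall>\<alpha>\<in>S. \<forall>\<beta>\<in>S. f (\<alpha> * \<beta>) = f \<beta> * f \<alpha>) \<and> (\<forall>\<alpha>\<in>S. f (f \<alpha>) = \<alpha>) \<and> f 1 = 1"

definition fixed_set :: "'a set \<Rightarrow> ('a \<Rightarrow> 'a) \<Rightarrow> 'a set" where
  "fixed_set S f = {\<alpha>\<in>S. f \<alpha> = \<alpha>}"

text \<open>\<open>fixed_chain f i\<close> is the set \<open>S\<^sub>i\<close>; the maps are indexed from \<open>1\<close>, so \<open>f 0\<close> is unused.\<close>

primrec fixed_chain :: "(nat \<Rightarrow> 'a \<Rightarrow> 'a) \<Rightarrow> nat \<Rightarrow> 'a set" where
  "fixed_chain f 0 = UNIV"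
| "fixed_chain f (Suc i) = fixed_set (fixed_chain f i) (f (Suc i))"

definition star_map :: "('a::times \<Rightarrow> 'a) \<Rightarrow> 'a \<Rightarrow> 'a" where
  "star_map f \<alpha> = \<alpha> * f \<alpha>"

definition natural_map :: "('a::times \<Rightarrow> 'a) \<Rightarrow> 'a \<Rightarrow> 'a" where
  "natural_map f \<alpha> = f \<alpha> * \<alpha>"

primrec comp_upto :: "(nat \<Rightarrow> 'a \<Rightarrow> 'a) \<Rightarrow> nat \<Rightarrow> 'a \<Rightarrow> 'a" where
  "comp_upto g 0 = id"
| "comp_upto g (Suc i) = g (Suc i) \<circ> comp_upto g i"

definition iterated_star :: "(nat \<Rightarrow> 'a::times \<Rightarrow> 'a) \<Rightarrow> nat \<Rightarrow> 'a \<Rightarrow> 'a" where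
  "iterated_star f k = comp_upto (\<lambda>i. star_map (f i)) k"

definition iterated_natural :: "(nat \<Rightarrow> 'a::times \<Rightarrow> 'a) \<Rightarrow> nat \<Rightarrow> 'a \<Rightarrow> 'a" where
  "iterated_natural f k = comp_upto (\<lambda>i. natural_map (f i)) k"

definition set_product :: "'a::times set \<Rightarrow> 'a set \<Rightarrow> 'a set" where
  "set_product S T = {\<alpha> * \<beta> | \<alpha> \<beta>. \<alpha> \<in> S \<and> \<beta> \<in> T}"

definition invertible_in :: "'a::monoid_mult set \<Rightarrow> 'a \<Rightarrow> bool" where
  "invertible_in M \<alpha> \<longleftrightarrow> \<alpha> \<in> M \<and> (\<exists>\<beta>\<in>M. \<alpha> * \<beta> = 1 \<and> \<beta> * \<alpha> = 1)"

definition invertibility_preserving ::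
    "'a::monoid_mult set \<Rightarrow> 'a set \<Rightarrow> ('a \<Rightarrow> 'a) \<Rightarrow> bool" where
  "invertibility_preserving M N g \<longleftrightarrow>
     (\<forall>\<alpha>\<in>M. g \<alpha> \<in> N) \<and> (\<forall>\<alpha>\<in>M. invertible_in M \<alpha> \<longleftrightarrow> invertible_in N (g \<alpha>))"

section \<open>Existence of Clifford algebras\<close>

text \<open>
  A model of \<open>clifford_algebra\<close> for \<open>p = LENGTH('p)\<close> and \<open>q = LENGTH('q)\<close>, over any field; every
  natural number, \<open>0\<close> included, is the length of a numeral type.  Elements are coefficient
  functions on the subsets of \<open>{1..p + q}\<close>, multiplied by
  \<open>e\<^sub>A e\<^sub>B = (\<Prod>a\<in>A. \<Prod>b\<in>B. \<epsilon> a b) e\<^sub>C\<close> with \<open>C\<close> the symmetric difference of \<open>A\<close> and \<open>B\<close>.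
\<close>

definition eps :: "nat \<Rightarrow> nat \<Rightarrow> nat \<Rightarrow> 'k::comm_ring_1" where
  "eps p a b = (if a < b then 1 else if b < a then - 1 else if a \<le> p then - 1 else 1)"

definition eps_set :: "nat \<Rightarrow> nat set \<Rightarrow> nat set \<Rightarrow> 'k::comm_ring_1" where
  "eps_set p A B = (\<Prod>a\<in>A. \<Prod>b\<in>B. eps p a b)"

lemma eps_square: "eps p a b * eps p a b = 1"
  by (simp add: eps_def)

lemma prod_sym_diff:
  fixes t :: "'b \<Rightarrow> 'k::comm_ring_1"
  assumes "finite A" "finite B" "\<And>x. t x * t x = 1"
  shows "prod t (sym_diff A B) = prod t A * prod t B"
proof -
  have A: "prod t A = prod t (A - B) * prod t (A \<inter> B)"
    using assms(1) by (metis mult.commute prod.Int_Diff)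
  have B: "prod t B = prod t (B - A) * prod t (A \<inter> B)"
    using assms(2) by (metis inf_commute mult.commute prod.Int_Diff)
  have sq: "prod t (A \<inter> B) * prod t (A \<inter> B) = 1"
    by (simp add: prod.distrib[symmetric] assms(3))
  have "prod t (sym_diff A B) = prod t (A - B) * prod t (B - A)"
    by (rule prod.union_disjoint) (use assms in auto)
  also have "\<dots> = prod t (A - B) * prod t (B - A) * (prod t (A \<inter> B) * prod t (A \<inter> B))"
    by (simp add: sq)
  also have "\<dots> = prod t A * prod t B"
    unfolding A B by (simp add: mult_ac)
  finally show ?thesis .
qed

lemma eps_set_square: "eps_set p A B * eps_set p A B = (1 :: 'k::comm_ring_1)"
  by (simp add: eps_set_def prod.distrib[symmetric] eps_square)

lemma eps_set_sym_diff_left: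
  "\<lbrakk>finite A; finite B\<rbrakk> \<Longrightarrow>
    eps_set p (sym_diff A B) C = eps_set p A C * (eps_set p B C :: 'k::comm_ring_1)"
  unfolding eps_set_def
  by (rule prod_sym_diff) (auto simp: prod.distrib[symmetric] eps_square)

lemma eps_set_sym_diff_right:
  "\<lbrakk>finite B; finite C\<rbrakk> \<Longrightarrow>
    eps_set p A (sym_diff B C) = eps_set p A B * (eps_set p A C :: 'k::comm_ring_1)"
  unfolding eps_set_def prod.distrib[symmetric]
  by (rule prod.cong[OF refl], rule prod_sym_diff) (auto simp: eps_square)

lemma eps_set_empty [simp]: "eps_set p {} B = 1" "eps_set p A {} = 1"
  by (simp_all add: eps_set_def)

typedef (overloaded) ('k, 'p, 'q) clifford =
  "{f :: nat set \<Rightarrow> 'k::field. \<forall>A. \<not> A \<subseteq> {1..LENGTH('p::len0) + LENGTH('q::len0)} \<longrightarrow> f A = 0}"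
  morphisms coef Clifford
  by (rule exI[of _ "\<lambda>_. 0"]) simp

setup_lifting type_definition_clifford

instantiation clifford :: (field, len0, len0) ring_1
begin

lift_definition zero_clifford :: "('a, 'b, 'c) clifford" is "\<lambda>_. 0" by simp

lift_definition one_clifford :: "('a, 'b, 'c) clifford" is "\<lambda>A. if A = {} then 1 else 0" by auto

lift_definition plus_clifford ::
  "('a, 'b, 'c) clifford \<Rightarrow> ('a, 'b, 'c) clifford \<Rightarrow> ('a, 'b, 'c) clifford"
  is "\<lambda>f g A. f A + g A" by simp

lift_definition minus_clifford ::
  "('a, 'b, 'c) clifford \<Rightarrow> ('a, 'b, 'c) clifford \<Rightarrow> ('a, 'b, 'c) clifford"
  is "\<lambda>f g A. f A - g A" by simp

lift_definition uminus_clifford :: "('a, 'b, 'c) clifford \<Rightarrow> ('a, 'b, 'c) clifford"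
  is "\<lambda>f A. - f A" by simp

lift_definition times_clifford ::
  "('a, 'b, 'c) clifford \<Rightarrow> ('a, 'b, 'c) clifford \<Rightarrow> ('a, 'b, 'c) clifford"
  is "\<lambda>f g C. if C \<subseteq> {1..LENGTH('b) + LENGTH('c)} then
    \<Sum>A\<in>Pow {1..LENGTH('b) + LENGTH('c)}.
      eps_set LENGTH('b) A (sym_diff A C) * f A * g (sym_diff A C) else 0" by simp

lemma clifford_mult_assoc:
  fixes f g h :: "nat set \<Rightarrow> 'k::field"
  assumes D: "D \<subseteq> {1..n}"
  shows "(\<Sum>C\<in>Pow {1..n}. eps_set m C (sym_diff C D) *
            (\<Sum>A\<in>Pow {1..n}. eps_set m A (sym_diff A C) * f A * g (sym_diff A C)) *
            h (sym_diff C D)) =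
         (\<Sum>A\<in>Pow {1..n}. eps_set m A (sym_diff A D) * f A *
            (\<Sum>B\<in>Pow {1..n}. eps_set m B (sym_diff B (sym_diff A D)) * g B *
               h (sym_diff B (sym_diff A D))))" (is "?L = ?R")
proof -
  have inner: "(\<Sum>B\<in>Pow {1..n}. eps_set m A (sym_diff A D) * f A *
            (eps_set m B (sym_diff B (sym_diff A D)) * g B * h (sym_diff B (sym_diff A D)))) =
      (\<Sum>C\<in>Pow {1..n}. eps_set m C (sym_diff C D) *
            (eps_set m A (sym_diff A C) * f A * g (sym_diff A C)) * h (sym_diff C D))"
    (is "sum ?u _ = sum ?v _") if A: "A \<in> Pow {1..n}" for A
  proof (rule sum.reindex_bij_witness[of _ "\<lambda>C. sym_diff A C" "\<lambda>B. sym_diff A B"])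
    fix B assume B: "B \<in> Pow {1..n}"
    show "sym_diff A (sym_diff A B) = B" by blast
    show "sym_diff A B \<in> Pow {1..n}" using A B by blast
    have fin: "finite A" "finite B" "finite D"
      using A B D by (auto intro: finite_subset)
    have e1: "sym_diff B (sym_diff A D) = sym_diff (sym_diff A B) D" by blast
    have e2: "sym_diff A (sym_diff A B) = B" by blast
    define s1 s2 s3 s4 :: 'k where "s1 = eps_set m (sym_diff A B) (sym_diff (sym_diff A B) D)"
      and "s2 = eps_set m A B" and "s3 = eps_set m A (sym_diff A D)"
      and "s4 = eps_set m B (sym_diff (sym_diff A B) D)"
    have "eps_set m A (sym_diff (sym_diff A B) D) = s2 * s3"
      unfolding s2_def s3_def e1[symmetric] using fin
      by (simp only: eps_set_sym_diff_right finite_Un finite_Diff)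
    then have "s1 = s2 * s3 * s4"
      unfolding s1_def s4_def using fin by (simp only: eps_set_sym_diff_left)
    moreover have "s2 * s2 = 1"
      by (simp add: s2_def eps_set_square)
    ultimately have "s1 * s2 = s3 * s4"
      by (metis mult.assoc mult.commute mult.right_neutral)
    then have "s1 * s2 * (f A * g B * h (sym_diff (sym_diff A B) D)) =
               s3 * s4 * (f A * g B * h (sym_diff (sym_diff A B) D))"
      by (simp only:)
    then show "?v (sym_diff A B) = ?u B"
      unfolding e1 e2 s1_def[symmetric] s2_def[symmetric] s3_def[symmetric] s4_def[symmetric]
      by (simp only: mult_ac)
  next
    fix C assume C: "C \<in> Pow {1..n}"
    show "sym_diff A (sym_diff A C) = C" by blast
    show "sym_diff A C \<in> Pow {1..n}" using A C by blast
  qed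
  have "?R = (\<Sum>A\<in>Pow {1..n}. \<Sum>C\<in>Pow {1..n}. eps_set m C (sym_diff C D) *
            (eps_set m A (sym_diff A C) * f A * g (sym_diff A C)) * h (sym_diff C D))"
    unfolding sum_distrib_left by (rule sum.cong[OF refl], rule inner)
  also have "\<dots> = ?L"
    by (subst sum.swap) (simp add: sum_distrib_left sum_distrib_right)
  finally show ?thesis by simp
qed

instance
proof
  fix a b c :: "('a, 'b, 'c) clifford"
  show "a * b * c = a * (b * c)"
  proof (transfer, rule ext)
    fix f g h :: "nat set \<Rightarrow> 'a" and D :: "nat set"
    let ?N = "{1..LENGTH('b) + LENGTH('c)}"
    show "(if D \<subseteq> ?N then \<Sum>A\<in>Pow ?N. eps_set LENGTH('b) A (sym_diff A D) *
        (if A \<subseteq> ?N then \<Sum>B\<in>Pow ?N. eps_set LENGTH('b) B (sym_diff B A) * f B * g (sym_diff B A)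
         else 0) * h (sym_diff A D) else 0) =
      (if D \<subseteq> ?N then \<Sum>A\<in>Pow ?N. eps_set LENGTH('b) A (sym_diff A D) * f A *
        (if sym_diff A D \<subseteq> ?N then \<Sum>B\<in>Pow ?N. eps_set LENGTH('b) B (sym_diff B (sym_diff A D)) *
           g B * h (sym_diff B (sym_diff A D)) else 0) else 0)"
    proof (cases "D \<subseteq> ?N")
      case True
      have sub: "sym_diff A D \<subseteq> ?N" if "A \<in> Pow ?N" for A
        using that True by blast
      show ?thesis
        unfolding if_P[OF True]
        by (rule trans[OF _ trans[OF clifford_mult_assoc[OF True, of "LENGTH('b)" f g h]]];
            rule sum.cong[OF refl]) (use sub in \<open>auto simp del: Un_subset_iff\<close>)
    qed simp
  qed
  show "1 * a = a"
  proof (transfer, rule ext)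
    fix f :: "nat set \<Rightarrow> 'a" and D :: "nat set"
    let ?N = "{1..LENGTH('b) + LENGTH('c)}"
    assume f: "\<forall>A. \<not> A \<subseteq> ?N \<longrightarrow> f A = 0"
    have "(\<Sum>A\<in>Pow ?N. eps_set LENGTH('b) A (sym_diff A D) * (if A = {} then 1 else 0) *
            f (sym_diff A D)) = (\<Sum>A\<in>Pow ?N. if A = {} then f D else 0)"
      by (rule sum.cong) auto
    then show "(if D \<subseteq> ?N then \<Sum>A\<in>Pow ?N. eps_set LENGTH('b) A (sym_diff A D) *
        (if A = {} then 1 else 0) * f (sym_diff A D) else 0) = f D"
      using f by simp
  qed
  show "a * 1 = a"
  proof (transfer, rule ext)
    fix f :: "nat set \<Rightarrow> 'a" and D :: "nat set"
    let ?N = "{1..LENGTH('b) + LENGTH('c)}"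
    assume f: "\<forall>A. \<not> A \<subseteq> ?N \<longrightarrow> f A = 0"
    have eq: "sym_diff A D = {} \<longleftrightarrow> A = D" for A by blast
    have "(\<Sum>A\<in>Pow ?N. eps_set LENGTH('b) A (sym_diff A D) * f A *
            (if sym_diff A D = {} then 1 else 0)) = (\<Sum>A\<in>Pow ?N. if A = D then f D else 0)"
      unfolding eq by (rule sum.cong) auto
    then show "(if D \<subseteq> ?N then \<Sum>A\<in>Pow ?N. eps_set LENGTH('b) A (sym_diff A D) * f A *
        (if sym_diff A D = {} then 1 else 0) else 0) = f D"
      using f by (simp add: sum.delta)
  qed
  show "(a + b) * c = a * c + b * c"
    by transfer (auto simp: algebra_simps sum.distrib)
  show "a * (b + c) = a * b + a * c"
    by transfer (auto simp: algebra_simps sum.distrib)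
  show "a + b + c = a + (b + c)" by transfer (simp add: add.assoc)
  show "a + b = b + a" by transfer (simp add: add.commute)
  show "0 + a = a" by transfer simp
  show "- a + a = 0" by transfer simp
  show "a - b = a + - b" by transfer simp
  show "(0::('a, 'b, 'c) clifford) \<noteq> 1" by transfer (metis zero_neq_one)
qed

end

lift_definition cscale :: "'k::field \<Rightarrow> ('k, 'p::len0, 'q::len0) clifford \<Rightarrow> ('k, 'p, 'q) clifford"
  is "\<lambda>c f A. c * f A" by simp

lift_definition cblade :: "nat set \<Rightarrow> ('k::field, 'p::len0, 'q::len0) clifford"
  is "\<lambda>A B. if A = B \<and> A \<subseteq> {1..LENGTH('p) + LENGTH('q)} then 1 else 0" by simp

lemma cblade_mult:
  assumes A: "A \<subseteq> {1..LENGTH('p) + LENGTH('q)}" and B: "B \<subseteq> {1..LENGTH('p) + LENGTH('q)}"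
  shows "cblade A * cblade B =
    (cscale (eps_set LENGTH('p) A B) (cblade (sym_diff A B)) :: ('k::field, 'p::len0, 'q::len0) clifford)"
  using assms
proof (transfer, intro ext)
  fix A B D :: "nat set"
  let ?N = "{1..LENGTH('p) + LENGTH('q)}"
  assume A: "A \<subseteq> ?N" and B: "B \<subseteq> ?N"
  have AB: "sym_diff A B \<subseteq> ?N" using A B by blast
  have eq: "B = sym_diff A D \<longleftrightarrow> sym_diff A B = D" by blast
  have eq': "sym_diff A (sym_diff A B) = B" by blast
  have "(\<Sum>A'\<in>Pow ?N. eps_set LENGTH('p) A' (sym_diff A' D) *
          (if A = A' \<and> A \<subseteq> ?N then 1 else 0) * (if B = sym_diff A' D \<and> B \<subseteq> ?N then 1 else 0)) =
        (\<Sum>A'\<in>Pow ?N. if A' = A then eps_set LENGTH('p) A (sym_diff A D) *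
          (if B = sym_diff A D then 1 else 0 :: 'k) else 0)"
    using A B by (intro sum.cong) auto
  also have "\<dots> = eps_set LENGTH('p) A (sym_diff A D) * (if B = sym_diff A D then 1 else 0)"
    using A by simp
  also have "\<dots> = eps_set LENGTH('p) A B * (if sym_diff A B = D then 1 else 0)"
    unfolding eq using eq' by auto
  finally show "(if D \<subseteq> ?N then \<Sum>A'\<in>Pow ?N. eps_set LENGTH('p) A' (sym_diff A' D) *
          (if A = A' \<and> A \<subseteq> ?N then 1 else 0) * (if B = sym_diff A' D \<and> B \<subseteq> ?N then 1 else 0)
        else 0) =
      (eps_set LENGTH('p) A B * (if sym_diff A B = D \<and> sym_diff A B \<subseteq> ?N then 1 else 0) :: 'k)"
    using AB by auto
qed

lemma cscale_1: "cscale 1 x = x"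
  by transfer simp

lemma cscale_m1: "cscale (- 1) x = - x"
  by transfer simp

lemma cblade_empty: "cblade {} = 1"
  by transfer auto

lemma blade_cblade_list:
  assumes "sorted xs" "distinct xs" "set xs \<subseteq> {1..LENGTH('p) + LENGTH('q)}"
  shows "prod_list (map (\<lambda>i. cblade {i}) xs) =
    (cblade (set xs) :: ('k::field, 'p::len0, 'q::len0) clifford)"
  using assms
proof (induction xs)
  case Nil
  then show ?case by (simp add: cblade_empty)
next
  case (Cons x xs)
  have "eps LENGTH('p) x b = (1 :: 'k)" if "b \<in> set xs" for b
    using Cons.prems that by (fastforce simp: eps_def)
  then have "eps_set LENGTH('p) {x} (set xs) = (1 :: 'k)"
    by (simp add: eps_set_def)
  moreover have "sym_diff {x} (set xs) = set (x # xs)"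
    using Cons.prems by auto
  ultimately have "cblade {x} * cblade (set xs) =
      (cblade (set (x # xs)) :: ('k, 'p, 'q) clifford)"
    using Cons.prems cblade_mult[of "{x}" "set xs", where 'p = 'p and 'q = 'q and 'k = 'k]
    by (simp only: cscale_1) simp
  then show ?case
    using Cons by simp
qed

lemma blade_cblade:
  assumes "I \<subseteq> {1..LENGTH('p) + LENGTH('q)}"
  shows "blade (\<lambda>i. cblade {i}) I = (cblade I :: ('k::field, 'p::len0, 'q::len0) clifford)"
  using blade_cblade_list[of "sorted_list_of_set I", where 'p = 'p and 'q = 'q and 'k = 'k] assms
    finite_subset[OF assms]
  by (simp add: blade_def)

lemma coef_sum: "coef (sum g X) A = (\<Sum>x\<in>X. coef (g x) A)"
  by (induction X rule: infinite_finite_induct) (simp_all add: zero_clifford.rep_eq plus_clifford.rep_eq)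

theorem clifford_algebra_exists:
  "clifford_algebra cscale LENGTH('p) LENGTH('q)
     (\<lambda>i. cblade {i} :: ('k::field, 'p::len0, 'q::len0) clifford)"
proof -
  let ?N = "{1..LENGTH('p) + LENGTH('q)}"
  let ?e = "\<lambda>i. cblade {i} :: ('k, 'p, 'q) clifford"
  interpret vector_space "cscale :: 'k \<Rightarrow> ('k, 'p, 'q) clifford \<Rightarrow> _"
    by unfold_locales (transfer, simp add: algebra_simps)+
  have im: "blade ?e ` Pow ?N = cblade ` Pow ?N"
    by (auto simp: blade_cblade intro!: image_cong)
  have inj: "inj_on (cblade :: _ \<Rightarrow> ('k, 'p, 'q) clifford) (Pow ?N)"
  proof (rule inj_onI)
    fix A B assume "A \<in> Pow ?N" "B \<in> Pow ?N"
      and "(cblade A :: ('k, 'p, 'q) clifford) = cblade B"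
    then show "A = B"
      by (transfer, metis PowD zero_neq_one)
  qed
  have lincomb: "coef (\<Sum>A\<in>Pow ?N. cscale (u A) (cblade A) :: ('k, 'p, 'q) clifford) B =
      (if B \<subseteq> ?N then u B else 0)" for u B
  proof -
    have "coef (\<Sum>A\<in>Pow ?N. cscale (u A) (cblade A) :: ('k, 'p, 'q) clifford) B =
        (\<Sum>A\<in>Pow ?N. if A = B then u B else 0)"
      unfolding coef_sum cscale.rep_eq cblade.rep_eq by (intro sum.cong) auto
    then show ?thesis by simp
  qed
  show ?thesis
  proof unfold_locales
    fix c and x y :: "('k, 'p, 'q) clifford"
    show "cscale c x * y = cscale c (x * y)"
      by transfer (auto simp: sum_distrib_left mult_ac)
    show "x * cscale c y = cscale c (x * y)"
      by transfer (auto simp: sum_distrib_left mult_ac)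
  next
    fix i j assume ij: "i \<in> ?N" "j \<in> ?N" "i \<noteq> j"
    have "sym_diff {i} {j} = {i, j}" "sym_diff {j} {i} = {i, j}" using ij by auto
    moreover have "eps_set LENGTH('p) {i} {j} = - (eps_set LENGTH('p) {j} {i} :: 'k)"
      using ij by (auto simp: eps_set_def eps_def)
    moreover have "cscale (- c) x + cscale c x = 0" for c and x :: "('k, 'p, 'q) clifford"
      by transfer simp
    ultimately show "?e i * ?e j + ?e j * ?e i = 0"
      using ij by (simp add: cblade_mult)
  next
    fix i assume "i \<in> {1..LENGTH('p)}"
    then show "?e i * ?e i = - 1"
      by (simp add: cblade_mult eps_set_def eps_def cscale_m1 cblade_empty)
  next
    fix i assume "i \<in> {LENGTH('p) + 1..LENGTH('p) + LENGTH('q)}"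
    then show "?e i * ?e i = 1"
      by (simp add: cblade_mult eps_set_def eps_def cscale_1 cblade_empty)
  next
    show "inj_on (blade ?e) (Pow ?N)"
      using inj by (simp add: blade_cblade inj_on_def)
  next
    show "independent (blade ?e ` Pow ?N)"
      unfolding im
    proof (rule independent_if_scalars_zero)
      fix u :: "('k, 'p, 'q) clifford \<Rightarrow> 'k" and x :: "('k, 'p, 'q) clifford"
      assume 0: "(\<Sum>x\<in>cblade ` Pow ?N. cscale (u x) x) = 0" and "x \<in> cblade ` Pow ?N"
      then obtain B where B: "B \<subseteq> ?N" "x = cblade B" by auto
      have "(\<Sum>A\<in>Pow ?N. cscale (u (cblade A)) (cblade A :: ('k, 'p, 'q) clifford)) = 0"
        using 0 unfolding sum.reindex[OF inj] o_def .
      then show "u x = 0"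
        using lincomb[of "\<lambda>A. u (cblade A)" B] B by (simp add: zero_clifford.rep_eq)
    qed simp
  next
    have "x \<in> span (cblade ` Pow ?N)" for x :: "('k, 'p, 'q) clifford"
    proof -
      have "coef x B =
          coef (\<Sum>A\<in>Pow ?N. cscale (coef x A) (cblade A) :: ('k, 'p, 'q) clifford) B" for B
        unfolding lincomb[of "coef x" B] using coef[of x] by auto
      then have "x = (\<Sum>A\<in>Pow ?N. cscale (coef x A) (cblade A))"
        by (intro iffD1[OF coef_inject] ext)
      also have "\<dots> \<in> span (cblade ` Pow ?N)"
        by (intro span_sum span_scale span_base) auto
      finally show ?thesis .
    qed
    then show "span (blade ?e ` Pow ?N) = UNIV"
      unfolding im by auto
  qed
qed

end

theory Submission
  imports Defs
begin

text \<open>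
  Each \<open>S\<^sub>i\<close> need not be closed under multiplication, but it is closed under taking inverses in the
  whole algebra: if \<open>\<alpha> \<in> S\<^sub>i\<close> has inverse \<open>\<beta> \<in> S\<^bsub>i-1\<^esub>\<close>, then applying \<open>f\<^sub>i\<close> to \<open>\<alpha>\<beta> = 1\<close> gives
  \<open>f\<^sub>i(\<beta>) \<alpha> = 1\<close>, hence \<open>f\<^sub>i(\<beta>) = \<beta>\<close>.  So an invertible \<open>\<alpha> \<in> S\<^bsub>i-1\<^esub>\<close> has an invertible image
  \<open>f\<^sub>i(\<alpha>)\<close>, and \<open>\<alpha> f\<^sub>i(\<alpha>)\<close> is invertible.  Conversely, if \<open>\<alpha> f\<^sub>i(\<alpha>)\<close> is invertible then \<open>\<alpha>\<close> has a
  one-sided inverse, which is two-sided because the algebra has finite dimension.  Grade-negation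
  operators are simultaneously diagonal, so \<open>f\<^sub>i\<close> maps \<open>S\<^bsub>i-1\<^esub>\<close> to itself; \<open>\<alpha> f\<^sub>i(\<alpha>)\<close> is then fixed
  by \<open>f\<^sub>i\<close>, and either of the two conditions puts it into \<open>S\<^sub>i\<close>.
\<close>

text \<open>For members of such a set, having an inverse within the set and having one in the whole
  monoid are equivalent, even if the set is not closed under products.\<close>

definition inverse_closed :: "'a::monoid_mult set \<Rightarrow> bool" where
  "inverse_closed S \<longleftrightarrow> (\<forall>\<alpha>\<in>S. \<forall>\<beta>. \<alpha> * \<beta> = 1 \<longrightarrow> \<beta> * \<alpha> = 1 \<longrightarrow> \<beta> \<in> S)"

lemma inverse_closedD: "\<lbrakk>inverse_closed S; \<alpha> \<in> S; \<alpha> * \<beta> = 1; \<beta> * \<alpha> = 1\<rbrakk> \<Longrightarrow> \<beta> \<in> S"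
  by (simp add: inverse_closed_def)

lemma mult_inverses:
  fixes a b c d :: "'a::monoid_mult"
  assumes "a * b = 1" "c * d = 1"
  shows "(a * c) * (d * b) = 1"
  by (metis assms mult.assoc mult_1_left)

lemma partial_involution_fixed_set_inverse_closed:
  assumes f: "partial_involution f S" and S: "inverse_closed S"
  shows "inverse_closed (fixed_set S f)"
  unfolding inverse_closed_def
proof (intro ballI allI impI)
  fix \<alpha> \<beta> assume \<alpha>: "\<alpha> \<in> fixed_set S f" and inv: "\<alpha> * \<beta> = 1" "\<beta> * \<alpha> = 1"
  have \<alpha>S: "\<alpha> \<in> S" "f \<alpha> = \<alpha>" using \<alpha> by (auto simp: fixed_set_def)
  have \<beta>: "\<beta> \<in> S" using inverse_closedD[OF S \<alpha>S(1) inv] .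
  have "f \<beta> * \<alpha> = 1"
    using f \<alpha>S \<beta> inv unfolding partial_involution_def by metis
  then have "f \<beta> = \<beta>" by (metis inv(1) mult.assoc mult_1_left mult_1_right)
  with \<beta> show "\<beta> \<in> fixed_set S f" by (simp add: fixed_set_def)
qed

lemma fixed_chain_inverse_closed:
  assumes "\<And>i. i \<in> {1..k} \<Longrightarrow> partial_involution (f i) (fixed_chain f (i - 1))"
  shows "inverse_closed (fixed_chain f k)"
  using assms
proof (induction k)
  case 0
  then show ?case by (simp add: inverse_closed_def)
next
  case (Suc k)
  have "partial_involution (f (Suc k)) (fixed_chain f k)"
    using Suc.prems[of "Suc k"] by simp
  moreover have "inverse_closed (fixed_chain f k)"
    using Suc.prems by (intro Suc.IH) auto
  ultimately show ?case
    by (simp add: partial_involution_fixed_set_inverse_closed)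
qed

text \<open>Commuting with a map preserves its fixed points. Applied with \<open>g\<close> the next
  map of the sequence, to be restricted to this set.\<close>

lemma fixed_chain_commuting_image:
  assumes "\<And>j x. j \<in> {1..i} \<Longrightarrow> g (f j x) = f j (g x)" and "x \<in> fixed_chain f i"
  shows "g x \<in> fixed_chain f i"
  using assms
proof (induction i)
  case (Suc i)
  have "x \<in> fixed_chain f i" and x: "f (Suc i) x = x"
    using Suc.prems(2) by (auto simp: fixed_set_def)
  then have "g x \<in> fixed_chain f i"
    using Suc.prems(1) by (intro Suc.IH) auto
  moreover have "f (Suc i) (g x) = g x"
    using Suc.prems(1)[of "Suc i" x] x by simp
  ultimately show ?case by (simp add: fixed_set_def)
qed simp

lemma partial_involution_image_invertible:
  assumes "partial_involution f S" "\<alpha> \<in> S" "\<beta> \<in> S" "\<alpha> * \<beta> = 1" "\<beta> * \<alpha> = 1"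
  shows "f \<alpha> * f \<beta> = 1" "f \<beta> * f \<alpha> = 1"
proof -
  have "f (\<beta> * \<alpha>) = f \<alpha> * f \<beta>" "f (\<alpha> * \<beta>) = f \<beta> * f \<alpha>" "f 1 = 1"
    using assms(1-3) by (auto simp: partial_involution_def)
  with assms(4,5) show "f \<alpha> * f \<beta> = 1" "f \<beta> * f \<alpha> = 1" by simp_all
qed

text \<open>As \<open>f\<close> reverses products only on \<open>S\<close>, stability of
  \<open>S\<close> is what gives
  \<open>f (\<alpha> * f \<alpha>) = f (f \<alpha>) * f \<alpha>\<close>. It also makes both
  elements products of two members of \<open>S\<close>, as the second alternative requires.\<close>

lemma partial_involution_products_in_fixed_set:
  assumes f: "partial_involution f S" "f ` S \<subseteq> S"
    and cond: "fixed_set UNIV f \<subseteq> S \<or> set_product S S \<inter> fixed_set UNIV f \<subseteq> fixed_set S f"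
    and \<alpha>: "\<alpha> \<in> S"
  shows "\<alpha> * f \<alpha> \<in> fixed_set S f" "f \<alpha> * \<alpha> \<in> fixed_set S f"
proof -
  have f\<alpha>: "f \<alpha> \<in> S" "f (f \<alpha>) = \<alpha>"
    using f \<alpha> by (auto simp: partial_involution_def)
  have "f (\<alpha> * f \<alpha>) = \<alpha> * f \<alpha>" "f (f \<alpha> * \<alpha>) = f \<alpha> * \<alpha>"
    using f(1) \<alpha> f\<alpha> by (auto simp: partial_involution_def)
  moreover have "\<alpha> * f \<alpha> \<in> set_product S S" "f \<alpha> * \<alpha> \<in> set_product S S"
    using \<alpha> f\<alpha> by (auto simp: set_product_def)
  ultimately show "\<alpha> * f \<alpha> \<in> fixed_set S f" "f \<alpha> * \<alpha> \<in> fixed_set S f"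
    using cond by (auto simp: fixed_set_def)
qed

lemma star_natural_map_invertibility_preserving:
  assumes dedekind_finite: "\<And>a b :: 'a::monoid_mult. a * b = 1 \<Longrightarrow> b * a = 1"
    and S: "inverse_closed (S :: 'a set)"
    and f: "partial_involution f S" "f ` S \<subseteq> S"
    and cond: "fixed_set UNIV f \<subseteq> S \<or> set_product S S \<inter> fixed_set UNIV f \<subseteq> fixed_set S f"
  shows "invertibility_preserving S (fixed_set S f) (star_map f)"
    and "invertibility_preserving S (fixed_set S f) (natural_map f)"
proof -
  \<comment> \<open>Reduces invertibility in \<open>S\<close> and in its fixed set to one condition
    in the whole monoid, the existence of a right inverse.\<close>
  have inv_iff: "invertible_in T \<alpha> \<longleftrightarrow> (\<exists>\<beta>. \<alpha> * \<beta> = 1)" if "inverse_closed T" "\<alpha> \<in> T" for T and \<alpha> :: 'a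
    using that dedekind_finite unfolding invertible_in_def inverse_closed_def by blast
  have fixed: "inverse_closed (fixed_set S f)"
    by (rule partial_involution_fixed_set_inverse_closed[OF f(1) S])
  have star: "(\<exists>\<beta>. \<alpha> * \<beta> = 1) \<longleftrightarrow> (\<exists>\<beta>. (\<alpha> * f \<alpha>) * \<beta> = 1)"
    and natural: "(\<exists>\<beta>. \<alpha> * \<beta> = 1) \<longleftrightarrow> (\<exists>\<beta>. (f \<alpha> * \<alpha>) * \<beta> = 1)" if \<alpha>: "\<alpha> \<in> S" for \<alpha>
  proof -
    have "\<exists>\<beta>. (\<alpha> * f \<alpha>) * \<beta> = 1" "\<exists>\<beta>. (f \<alpha> * \<alpha>) * \<beta> = 1" if \<beta>: "\<alpha> * \<beta> = 1" for \<beta>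
    proof -
      have "\<beta> \<in> S" using inverse_closedD[OF S \<alpha> \<beta> dedekind_finite[OF \<beta>]] .
      then have "f \<alpha> * f \<beta> = 1"
        using partial_involution_image_invertible[OF f(1) \<alpha>] \<beta> dedekind_finite by blast
      with \<beta> show "\<exists>\<beta>. (\<alpha> * f \<alpha>) * \<beta> = 1" "\<exists>\<beta>. (f \<alpha> * \<alpha>) * \<beta> = 1"
        using mult_inverses by blast+
    qed
    moreover have "\<exists>\<beta>. \<alpha> * \<beta> = 1" if "(\<alpha> * f \<alpha>) * \<beta> = 1" for \<beta>
      using that by (auto simp: mult.assoc)
    moreover have "\<exists>\<beta>. \<alpha> * \<beta> = 1" if "(f \<alpha> * \<alpha>) * \<beta> = 1" for \<beta>
    proof -
      \<comment> \<open>Here \<open>\<alpha>\<close> is the right factor, so \<open>\<beta>\<close>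
        must first move to the left, giving a left inverse of \<open>\<alpha>\<close>.\<close>
      have "(\<beta> * f \<alpha>) * \<alpha> = 1"
        using dedekind_finite[OF that] by (simp add: mult.assoc)
      then show ?thesis using dedekind_finite by blast
    qed
    ultimately show "(\<exists>\<beta>. \<alpha> * \<beta> = 1) \<longleftrightarrow> (\<exists>\<beta>. (\<alpha> * f \<alpha>) * \<beta> = 1)"
      "(\<exists>\<beta>. \<alpha> * \<beta> = 1) \<longleftrightarrow> (\<exists>\<beta>. (f \<alpha> * \<alpha>) * \<beta> = 1)"
      by blast+
  qed
  note products = partial_involution_products_in_fixed_set[OF f cond]
  show "invertibility_preserving S (fixed_set S f) (star_map f)"
    unfolding invertibility_preserving_def star_map_def
    using products by (simp add: star[symmetric] inv_iff[OF S] inv_iff[OF fixed])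
  show "invertibility_preserving S (fixed_set S f) (natural_map f)"
    unfolding invertibility_preserving_def natural_map_def
    using products by (simp add: natural[symmetric] inv_iff[OF S] inv_iff[OF fixed])
qed

text \<open>Invertibility is relative to \<open>T i\<close>, so the target condition of each stage
  is literally the source condition of the next.\<close>

lemma comp_upto_invertibility_preserving:
  assumes "\<And>i. i \<in> {1..k} \<Longrightarrow> invertibility_preserving (T (i - 1)) (T i) (g i)"
  shows "invertibility_preserving (T 0) (T k) (comp_upto g k)"
  using assms
proof (induction k)
  case 0
  then show ?case by (simp add: invertibility_preserving_def)
next
  case (Suc k)
  have "invertibility_preserving (T 0) (T k) (comp_upto g k)"
    using Suc.prems by (intro Suc.IH) auto
  moreover have "invertibility_preserving (T k) (T (Suc k)) (g (Suc k))"
    using Suc.prems[of "Suc k"] by simp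
  ultimately show ?case by (simp add: invertibility_preserving_def)
qed

context clifford_algebra
begin

text \<open>Left multiplication by \<open>y\<close> is injective because \<open>x\<close> undoes it,
  hence surjective in finite dimension; a right inverse of \<open>y\<close> must then equal
  \<open>x\<close>.\<close>

lemma one_sided_inverse:
  fixes x y :: 'a
  assumes "x * y = 1"
  shows "y * x = 1"
proof -
  interpret finite_dimensional_vector_space scale "blade e ` Pow {1..p + q}"
    by unfold_locales (use blade_independent blade_span in auto)
  have "Vector_Spaces.linear scale scale (\<lambda>z. y * z)"
    by unfold_locales (simp_all add: distrib_left scale_mult_right)
  moreover have "inj (\<lambda>z. y * z)"
    by (rule injI) (metis assms mult.assoc mult_1_left)
  ultimately obtain z where "y * z = 1"
    using linear_inj_imp_surj by (metis surjD)
  moreover from this have "x = z"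
    by (metis assms mult.assoc mult_1_left mult_1_right)
  ultimately show ?thesis by simp
qed

text \<open>Both operators are diagonal in the blade basis, so they commute on blades and, by
  linearity, everywhere.\<close>

lemma grade_negation_commute:
  assumes "grade_negation scale p q e f" "grade_negation scale p q e g"
  shows "f (g x) = g (f x)"
proof -
  have lin: "Vector_Spaces.linear scale scale f" "Vector_Spaces.linear scale scale g"
    using assms by (auto simp: grade_negation_def)
  obtain \<delta> where f: "\<And>I. I \<subseteq> {1..p + q} \<Longrightarrow> f (blade e I) = scale (\<delta> (card I)) (blade e I)"
    using assms(1) by (auto simp: grade_negation_def)
  obtain \<delta>' where g: "\<And>I. I \<subseteq> {1..p + q} \<Longrightarrow> g (blade e I) = scale (\<delta>' (card I)) (blade e I)"
    using assms(2) by (auto simp: grade_negation_def)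
  interpret f: Vector_Spaces.linear scale scale f by fact
  interpret g: Vector_Spaces.linear scale scale g by fact
  interpret vector_space_pair scale scale by unfold_locales
  have "(f \<circ> g) x = (g \<circ> f) x"
  proof (rule linear_eq_on[of "f \<circ> g" "g \<circ> f" x "blade e ` Pow {1..p + q}"])
    show "Vector_Spaces.linear scale scale (f \<circ> g)" "Vector_Spaces.linear scale scale (g \<circ> f)"
      using lin by (auto intro: Vector_Spaces.linear_compose)
  qed (use blade_span in \<open>auto simp: f g f.scale g.scale mult.commute\<close>)
  then show ?thesis by simp
qed

end

theorem theorem7p1:
  fixes scale :: "'k::field \<Rightarrow> 'a::ring_1 \<Rightarrow> 'a"
    and p q k :: nat
    and e :: "nat \<Rightarrow> 'a"
    and f :: "nat \<Rightarrow> 'a \<Rightarrow> 'a"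
  assumes "clifford_algebra scale p q e"
    and "k \<ge> 1"
    and "\<And>i. i \<in> {1..k} \<Longrightarrow> grade_negation scale p q e (f i)"
    and "\<And>i. i \<in> {1..k} \<Longrightarrow> partial_involution (f i) (fixed_chain f (i - 1))"
    and "fixed_chain f k = scalars scale"
    and "\<And>i. i \<in> {1..k} \<Longrightarrow>
           fixed_set UNIV (f i) \<subseteq> fixed_chain f (i - 1) \<or>
           set_product (fixed_chain f (i - 1)) (fixed_chain f (i - 1)) \<inter> fixed_set UNIV (f i)
             \<subseteq> fixed_chain f i"
  shows "invertibility_preserving UNIV (scalars scale) (iterated_star f k) \<and>
         invertibility_preserving UNIV (scalars scale) (iterated_natural f k)"
proof -
  interpret clifford_algebra scale p q e by fact
  have commute: "f i (f j x) = f j (f i x)" if "i \<in> {1..k}" "j \<in> {1..k}" for i j x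
    using grade_negation_commute assms(3) that by blast
  have step: "invertibility_preserving (fixed_chain f (i - 1)) (fixed_chain f i) (star_map (f i))"
    "invertibility_preserving (fixed_chain f (i - 1)) (fixed_chain f i) (natural_map (f i))"
    if i: "i \<in> {1..k}" for i
  proof -
    have chain: "fixed_chain f i = fixed_set (fixed_chain f (i - 1)) (f i)"
      using i by (cases i) auto
    have closed: "inverse_closed (fixed_chain f (i - 1))"
      using i assms(4) by (intro fixed_chain_inverse_closed) auto
    have "f i (f j x) = f j (f i x)" if "j \<in> {1..i - 1}" for j x
      by (rule commute) (use i that in auto)
    then have image: "f i ` fixed_chain f (i - 1) \<subseteq> fixed_chain f (i - 1)"
      using fixed_chain_commuting_image[of "i - 1" "f i" f] by blast
    note preserving = star_natural_map_invertibility_preserving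
      [OF one_sided_inverse closed assms(4)[OF i] image assms(6)[OF i, unfolded chain]]
    show "invertibility_preserving (fixed_chain f (i - 1)) (fixed_chain f i) (star_map (f i))"
      "invertibility_preserving (fixed_chain f (i - 1)) (fixed_chain f i) (natural_map (f i))"
      \<comment> \<open>\<open>one_sided_inverse\<close> is itself an implication, so its hypothesis
        remains as a trivial premise for \<open>assumption\<close>.\<close>
      unfolding chain by (rule preserving, assumption)+
  qed
  show ?thesis
    using comp_upto_invertibility_preserving[of k "fixed_chain f" "\<lambda>i. star_map (f i)"]
      comp_upto_invertibility_preserving[of k "fixed_chain f" "\<lambda>i. natural_map (f i)"] step
    by (simp add: iterated_star_def iterated_natural_def assms(5))
qed

end
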